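(* Let $n\ge2$, $\alpha\in\mathbb{R}$ and $1\le p_1,p_2,\tilde p_1,q<\infty$. There is a constant $C>0$, independent of $f$ and $\Phi$, such that for every radial function $f\in\dot K^{\alpha,q}_{L^{p_2}_{\rm rad}L^{\tilde p_1}_{\rm ang}}(\mathbb{R}^n)$, $$\|\mathcal{H}_\Phi f\|_{\dot K^{\alpha,q}_{L^{p_2}_{\rm rad}L^{p_1}_{\rm ang}}(\mathbb{R}^n)}\le C\int_{\mathbb{R}^n}\frac{|\Phi(y)|}{|y|^n}|y|^{\frac n{p_2}+\alpha}\,dy\;\|f\|_{\dot K^{\alpha,q}_{L^{p_2}_{\rm rad}L^{\tilde p_1}_{\rm ang}}(\mathbb{R}^n)} .$$
   Context: $S^{n-1}$ is the unit sphere of $\mathbb{R}^n$ with surface Lebesgue measure $d\sigma$. For exponents $p_1,p_2$, $$\|f\|_{L^{p_2}_{\rm rad}L^{p_1}_{\rm ang}(\mathbb{R}^n)}=\Big(\int_0^\infty\Big(\int_{S^{n-1}}|f(r\theta)|^{p_1}d\sigma(\theta)\Big)^{p_2/p_1}r^{n-1}dr\Big)^{1/p_2}.$$ For $k\in\mathbb{Z}$, $\chi_k$ is the characteristic function of $\{x\in\mathbb{R}^n:2^{k-1}<|x|\le2^k\}$. The mixed radial-angular homogeneous Herz space $\dot K^{\alpha,q}_{L^{p_2}_{\rm rad}L^{p_1}_{\rm ang}}(\mathbb{R}^n)$ consists of the functions $f$, locally in $L^{p_2}_{\rm rad}L^{p_1}_{\rm ang}$ away from the origin, with $$\|f\|_{\dot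 K^{\alpha,q}_{L^{p_2}_{\rm rad}L^{p_1}_{\rm ang}}(\mathbb{R}^n)}=\Big\{\sum_{k=-\infty}^\infty2^{k\alpha q}\|f\chi_k\|^q_{L^{p_2}_{\rm rad}L^{p_1}_{\rm ang}(\mathbb{R}^n)}\Big\}^{1/q}<\infty.$$ For a measurable function $\Phi$ on $\mathbb{R}^n$, $$\mathcal{H}_\Phi f(x)=\int_{\mathbb{R}^n}\frac{\Phi(y)}{|y|^n}f\Big(\frac{x}{|y|}\Big)dy .$$ A function is radial if it depends only on $|x|$. The inequality has content when the integral constant on the right is finite. *)

theory Defs
  imports "HOL-Analysis.Analysis"
begin

text \<open>
  All norms take values in \<^typ>\<open>ennreal\<close>, so that they make sense (possibly with value \<open>\<infinity>\<close>)
  for every function. The power below is only meant for exponents \<open>a > 0\<close>.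
\<close>

definition ennreal_rpow :: "ennreal \<Rightarrow> real \<Rightarrow> ennreal" where
  "ennreal_rpow x a = (if x = \<infinity> then \<infinity> else ennreal (enn2real x powr a))"

text \<open>
  Surface measure on the unit sphere, on its Borel sets, as the cone measure
  \<open>\<sigma>(A) = n \<cdot> |{r \<theta> : 0 < r < 1, \<theta> \<in> A}|\<close>. It is the measure for which
  \<open>dx = r\<^sup>n\<^sup>-\<^sup>1 dr d\<sigma>(\<theta>)\<close> in polar coordinates.
\<close>

definition sphere_measure :: "(real ^ 'n) measure" where
  "sphere_measure =
     scale_measure (of_nat CARD('n))
       (distr (restrict_space lborel (ball (0 :: real ^ 'n) 1 - {0}))
              (restrict_space borel (sphere 0 1))
              (\<lambda>x. x /\<^sub>R norm x))"

text \<open>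
  The norm of \<open>L\<^sup>p\<^sup>2\<close> in the radius with values in \<open>L\<^sup>p\<^sup>1\<close> on the sphere. The nonnegative integral
  with respect to a measure agrees with the one with respect to its completion
  (\<open>nn_integral_completion\<close>), so Lebesgue measurable \<open>f\<close> are covered as well.
\<close>

definition rad_ang_norm :: "real \<Rightarrow> real \<Rightarrow> (real ^ 'n \<Rightarrow> complex) \<Rightarrow> ennreal" where
  "rad_ang_norm p2 p1 f =
     ennreal_rpow
       (\<integral>\<^sup>+ r \<in> {0<..}.
          (ennreal_rpow (\<integral>\<^sup>+ \<theta>. ennreal (norm (f (r *\<^sub>R \<theta>)) powr p1) \<partial>sphere_measure) (p2 / p1)
             * ennreal (r ^ (CARD('n) - 1))) \<partial>lborel)
       (1 / p2)"

definition dyadic_shell :: "int \<Rightarrow> (real ^ 'n) set" where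
  "dyadic_shell k = {x. 2 powr (of_int k - 1) < norm x \<and> norm x \<le> 2 powr (of_int k)}"

definition herz_norm :: "real \<Rightarrow> real \<Rightarrow> real \<Rightarrow> real \<Rightarrow> (real ^ 'n \<Rightarrow> complex) \<Rightarrow> ennreal" where
  "herz_norm \<alpha> q p2 p1 f =
     ennreal_rpow
       (\<Sum>\<^sub>\<infinity>k\<in>(UNIV :: int set).
          ennreal (2 powr (of_int k * \<alpha> * q)) *
          ennreal_rpow (rad_ang_norm p2 p1 (\<lambda>x. f x * indicator (dyadic_shell k) x)) q)
       (1 / q)"

definition herz_space :: "real \<Rightarrow> real \<Rightarrow> real \<Rightarrow> real \<Rightarrow> (real ^ 'n \<Rightarrow> complex) set" where
  "herz_space \<alpha> q p2 p1 =
     {f. f \<in> borel_measurable lebesgue \<and>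
         (\<forall>K. compact K \<and> 0 \<notin> K \<longrightarrow> rad_ang_norm p2 p1 (\<lambda>x. f x * indicator K x) < \<infinity>) \<and>
         herz_norm \<alpha> q p2 p1 f < \<infinity>}"

definition radial :: "(real ^ 'n \<Rightarrow> complex) \<Rightarrow> bool" where
  "radial f \<longleftrightarrow> (\<forall>x y. norm x = norm y \<longrightarrow> f x = f y)"

definition hausdorff_integrand ::
    "(real ^ 'n \<Rightarrow> complex) \<Rightarrow> (real ^ 'n \<Rightarrow> complex) \<Rightarrow> real ^ 'n \<Rightarrow> real ^ 'n \<Rightarrow> complex" where
  "hausdorff_integrand \<Phi> f x y = \<Phi> y / of_real (norm y ^ CARD('n)) * f (x /\<^sub>R norm y)"

definition hausdorff_op ::
    "(real ^ 'n \<Rightarrow> complex) \<Rightarrow> (real ^ 'n \<Rightarrow> complex) \<Rightarrow> real ^ 'n \<Rightarrow> complex" where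
  "hausdorff_op \<Phi> f x = (\<integral>y. hausdorff_integrand \<Phi> f x y \<partial>lebesgue)"

text \<open>The integral \<open>\<integral> |\<Phi>(y)| |y|\<^sup>-\<^sup>n |y|\<^sup>s dy\<close>.\<close>

definition hausdorff_const :: "real \<Rightarrow> (real ^ 'n \<Rightarrow> complex) \<Rightarrow> ennreal" where
  "hausdorff_const s \<Phi> =
     (\<integral>\<^sup>+ y. ennreal (norm (\<Phi> y) / norm y ^ CARD('n) * norm y powr s) \<partial>lebesgue)"

end

theory Submission
  imports Defs
begin

text \<open>
  If \<open>f(x) = g(|x|)\<close>, then \<open>H\<^sub>\<Phi> f\<close> is radial as well, so the angular integrals only contribute
  powers of the area \<open>\<omega>\<close> of the sphere and \<open>|H\<^sub>\<Phi> f(x)| \<le> \<integral> |\<Phi>(y)| |y|\<^sup>-\<^sup>n |g(|x| / |y|)| dy\<close> is a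
  superposition of dilates of \<open>|g|\<close>. By Minkowski's integral inequality its norm is at most the
  integral of the norms of the dilates. The dilate of \<open>g\<close> by \<open>s \<in> (2\<^sup>m\<^sup>-\<^sup>1, 2\<^sup>m]\<close> meets the \<open>k\<close>-th shell in
  values of \<open>g\<close> on the shells \<open>k - m\<close> and \<open>k - m + 1\<close>, so its Herz norm is at most a constant times
  \<open>s\<close> to the power \<open>n / p\<^sub>2 + \<alpha>\<close> times that of \<open>g\<close>.
\<close>

section \<open>Minkowski's integral inequality\<close>

lemma ennreal_rpow_0 [simp]: "ennreal_rpow 0 a = 0"
  by (simp add: ennreal_rpow_def)

lemma ennreal_rpow_top [simp]: "ennreal_rpow top a = top"
  by (simp add: ennreal_rpow_def)

lemma ennreal_rpow_ennreal [simp]: "0 \<le> x \<Longrightarrow> ennreal_rpow (ennreal x) a = ennreal (x powr a)"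
  by (simp add: ennreal_rpow_def)

lemma ennreal_rpow_1 [simp]: "ennreal_rpow x 1 = x"
  by (cases x) auto

lemma ennreal_rpow_eq_0_iff [simp]: "ennreal_rpow x a = 0 \<longleftrightarrow> x = 0"
  by (cases x) (auto simp: ennreal_rpow_def)

lemma ennreal_rpow_eq_top_iff [simp]: "ennreal_rpow x a = top \<longleftrightarrow> x = top"
  by (cases x) (auto simp: ennreal_rpow_def)

lemma ennreal_rpow_mono: "x \<le> y \<Longrightarrow> 0 \<le> a \<Longrightarrow> ennreal_rpow x a \<le> ennreal_rpow y a"
  by (cases x; cases y) (auto simp: powr_mono2 top_unique)

text \<open>True for every real exponent, negative ones included: in this encoding each power fixes
  both 0 and \<open>top\<close>, so \<open>0 * top = 0\<close> is respected on both sides.\<close>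

lemma ennreal_rpow_mult: "ennreal_rpow (x * y) a = ennreal_rpow x a * ennreal_rpow y a"
proof (cases "x = 0 \<or> y = 0")
  case False
  then show ?thesis
    by (cases x; cases y)
       (auto simp: ennreal_mult_top ennreal_top_mult powr_mult simp flip: ennreal_mult)
qed auto

lemma ennreal_rpow_rpow: "ennreal_rpow (ennreal_rpow x a) b = ennreal_rpow x (a * b)"
  by (cases x) (auto simp: powr_powr)

lemma borel_measurable_ennreal_rpow [measurable (raw)]:
  assumes [measurable]: "f \<in> borel_measurable M"
  shows "(\<lambda>x. ennreal_rpow (f x) a) \<in> borel_measurable M"
  unfolding ennreal_rpow_def infinity_ennreal_def by measurable

text \<open>The sum is at most twice the maximum. This crude constant serves roots
  (\<open>a = 1 / p\<close>) and powers (\<open>a = q\<close>) alike.\<close>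

lemma ennreal_rpow_add_le:
  assumes "0 \<le> a"
  shows "ennreal_rpow (x + y) a \<le> ennreal (2 powr a) * (ennreal_rpow x a + ennreal_rpow y a)"
proof -
  have "x + y \<le> ennreal 2 * max x y"
    by (auto simp: max_def mult_2 add_mono)
  then have "ennreal_rpow (x + y) a \<le> ennreal (2 powr a) * ennreal_rpow (max x y) a"
    using ennreal_rpow_mono[of "x + y" "ennreal 2 * max x y" a] assms by (simp add: ennreal_rpow_mult del: ennreal_numeral)
  also have "ennreal_rpow (max x y) a \<le> ennreal_rpow x a + ennreal_rpow y a"
    by (auto simp: max_def)
  finally show ?thesis by (simp add: mult_left_mono)
qed

section \<open>Tangent inequality and weighted Hoelder inequality\<close>

text \<open>The tangent of the convex function \<open>x powr p\<close> at \<open>c\<close> lies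
  below its graph. The point \<open>c\<close> stays free, to be chosen after integration.\<close>

lemma young_tangent:
  fixes u c p :: real
  assumes "1 \<le> p" "0 \<le> u" "0 < c"
  shows "p * c powr (p - 1) * u \<le> u powr p + (p - 1) * c powr p"
proof (cases "u = 0")
  case False
  have "(\<lambda>x. x powr p) u - (\<lambda>x. x powr p) c \<ge> (p * c powr (p - 1)) * (u - c)"
  proof (rule convex_on_imp_above_tangent[where A = "{0<..}"])
    show "((\<lambda>x. x powr p) has_real_derivative p * c powr (p - 1)) (at c within {0<..})"
      using assms by (auto intro!: derivative_eq_intros)
  qed (use assms False in \<open>auto simp: interior_open powr_convex\<close>)
  moreover have "p * c powr (p - 1) * c = p * c powr p"
    using assms by (simp add: powr_diff)
  ultimately show ?thesis
    by (simp add: right_diff_distrib left_diff_distrib)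
qed (use assms in simp)

text \<open>Note that \<open>0 powr (1 - p) = 0\<close>, which is harmless since \<open>F\<close> vanishes where the weight \<open>G\<close> does.\<close>

lemma weighted_young_ennreal:
  fixes F G :: ennreal
  assumes p: "1 \<le> p" and c: "0 < c" and G: "G < \<infinity>" and FG: "G = 0 \<Longrightarrow> F = 0"
  shows "ennreal (p * c powr (p - 1)) * F
    \<le> ennreal_rpow F p * ennreal_rpow G (1 - p) + ennreal ((p - 1) * c powr p) * G"
proof (cases "G = 0")
  case False
  then obtain g where g: "G = ennreal g" "0 < g"
    using G by (cases G) auto
  show ?thesis
  proof (cases F)
    case (real f)
    \<comment> \<open>The tangent inequality for the quotient \<open>f / g\<close>, multiplied by
      the weight \<open>g\<close>.\<close>
    have "g * (p * c powr (p - 1) * (f / g)) \<le> g * ((f / g) powr p + (p - 1) * c powr p)"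
      using young_tangent[OF p _ c, of "f / g"] real g by (intro mult_left_mono) auto
    moreover have "g * (f / g) powr p = f powr p * g powr (1 - p)"
      using g real by (simp add: powr_divide powr_diff)
    ultimately have "p * c powr (p - 1) * f \<le> f powr p * g powr (1 - p) + (p - 1) * c powr p * g"
      using g by (simp add: algebra_simps)
    then show ?thesis
      using g real p by (simp flip: ennreal_mult ennreal_plus)
  next
    case top
    then show ?thesis using g by (simp add: ennreal_top_mult)
  qed
qed (simp add: FG)

text \<open>Hoelder's inequality after splitting a power of the weight \<open>G\<close> off
  \<open>F\<close>. It comes from integrating the weighted tangent inequality and then optimising
  over \<open>c\<close>, which treats \<open>p = 1\<close> on the same footing as
  \<open>p > 1\<close>.\<close>

lemma hoelder_weighted:
  assumes [measurable]: "F \<in> borel_measurable M" "G \<in> borel_measurable M"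
    and p: "1 \<le> p"
    and FG: "AE y in M. G y < \<infinity> \<and> (G y = 0 \<longrightarrow> F y = 0)"
    and A: "(\<integral>\<^sup>+y. G y \<partial>M) = ennreal A" "0 < A"
  shows "ennreal_rpow (\<integral>\<^sup>+y. F y \<partial>M) p
    \<le> ennreal (A powr (p - 1)) * (\<integral>\<^sup>+y. ennreal_rpow (F y) p * ennreal_rpow (G y) (1 - p) \<partial>M)"
    (is "ennreal_rpow ?X p \<le> _ * ?Y")
proof -
  have le: "ennreal (p * c powr (p - 1)) * ?X \<le> ?Y + ennreal ((p - 1) * c powr p * A)" if c: "0 < c" for c
  proof -
    have "ennreal (p * c powr (p - 1)) * ?X = (\<integral>\<^sup>+y. ennreal (p * c powr (p - 1)) * F y \<partial>M)"
      by (simp add: nn_integral_cmult)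
    also have "\<dots> \<le> (\<integral>\<^sup>+y. ennreal_rpow (F y) p * ennreal_rpow (G y) (1 - p) + ennreal ((p - 1) * c powr p) * G y \<partial>M)"
      using FG by (intro nn_integral_mono_AE) (auto intro!: weighted_young_ennreal[OF p c])
    also have "\<dots> = ?Y + ennreal ((p - 1) * c powr p * A)"
      using A p by (simp add: nn_integral_add nn_integral_cmult ennreal_mult)
    finally show ?thesis .
  qed
  show ?thesis
  proof (cases ?X)
    case (real x)
    show ?thesis
    proof (cases "x = 0")
      case False
      then have x: "0 < x" using real by auto
      show ?thesis
      proof (cases ?Y)
        case (real y)
        \<comment> \<open>The choice \<open>c = x / A\<close> is optimal in \<open>le\<close>: both
          terms become multiples of \<open>x powr p / A powr (p - 1)\<close>, with coefficients
          \<open>p\<close> and \<open>p - 1\<close>.\<close>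
        have "p * (x / A) powr (p - 1) * x \<le> y + (p - 1) * (x / A) powr p * A"
          using le[of "x / A"] \<open>?X = ennreal x\<close> real x A p
          by (simp flip: ennreal_mult ennreal_plus)
        moreover have "(x / A) powr (p - 1) * x = x powr p / A powr (p - 1)"
          using x A by (simp add: powr_divide powr_diff)
        moreover have "(x / A) powr p * A = x powr p / A powr (p - 1)"
          using x A by (simp add: powr_divide powr_diff)
        ultimately have "p * (x powr p / A powr (p - 1)) \<le> y + (p - 1) * (x powr p / A powr (p - 1))"
          by (simp add: mult.assoc)
        then have "x powr p \<le> A powr (p - 1) * y"
          using A by (simp add: algebra_simps divide_simps)
        then show ?thesis
          using \<open>?X = ennreal x\<close> real x by (simp flip: ennreal_mult)
      next
        case top
        then show ?thesis using A by (simp add: ennreal_mult_top)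
      qed
    qed (simp add: real)
  next
    case top
    \<comment> \<open>For infinite \<open>?X\<close> a single \<open>c\<close>, here 1, is enough,
      since the second summand in \<open>le\<close> is finite.\<close>
    then have "?Y = top"
      using le[of 1] p by (simp add: ennreal_mult_top top_unique)
    then show ?thesis using A by (simp add: ennreal_mult_top)
  qed
qed

text \<open>For each \<open>x\<close>, Hoelder's inequality in \<open>y\<close> is applied with
  weight \<open>G y\<close>, the \<open>p\<close>-norm of \<open>F\<close> in \<open>x\<close>.
  After integrating over \<open>x\<close> and exchanging integrals, the \<open>p\<close>-th power of
  \<open>F\<close> integrates to that of \<open>G\<close>; the exponents \<open>p\<close> and
  \<open>1 - p\<close> combine to \<open>G\<close> itself, and the total is
  \<open>A powr (p - 1) * A\<close>.\<close>

theorem minkowski_integral_inequality: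
  fixes F :: "'a \<Rightarrow> 'b \<Rightarrow> ennreal"
  assumes N: "sigma_finite_measure N" and M: "sigma_finite_measure M"
    and F [measurable]: "case_prod F \<in> borel_measurable (N \<Otimes>\<^sub>M M)"
    and p: "1 \<le> p"
  shows "ennreal_rpow (\<integral>\<^sup>+x. ennreal_rpow (\<integral>\<^sup>+y. F x y \<partial>M) p \<partial>N) (1 / p)
    \<le> (\<integral>\<^sup>+y. ennreal_rpow (\<integral>\<^sup>+x. ennreal_rpow (F x y) p \<partial>N) (1 / p) \<partial>M)"
proof -
  interpret N: sigma_finite_measure N by fact
  interpret M: sigma_finite_measure M by fact
  interpret P: pair_sigma_finite N M ..
  interpret P': pair_sigma_finite M N ..
  define G where "G y = ennreal_rpow (\<integral>\<^sup>+x. ennreal_rpow (F x y) p \<partial>N) (1 / p)" for y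
  have [measurable]: "G \<in> borel_measurable M"
    unfolding G_def by measurable
  have [simp]: "p \<noteq> 0" using p by auto
  have Gp: "ennreal_rpow (G y) p = (\<integral>\<^sup>+x. ennreal_rpow (F x y) p \<partial>N)" for y
    by (simp add: G_def ennreal_rpow_rpow)
  \<comment> \<open>The weighted inequality asks for \<open>F x y = 0\<close> wherever
    \<open>G y = 0\<close>. This is clear for each \<open>y\<close> and almost every
    \<open>x\<close>; Fubini then interchanges the two quantifiers.\<close>
  have "AE y in M. AE x in N. G y = 0 \<longrightarrow> F x y = 0"
  proof (rule AE_I2)
    fix y assume [measurable]: "y \<in> space M"
    show "AE x in N. G y = 0 \<longrightarrow> F x y = 0"
    proof (cases "G y = 0")
      case True
      then have "(\<integral>\<^sup>+x. ennreal_rpow (F x y) p \<partial>N) = 0" by (simp add: G_def)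
      then have "AE x in N. ennreal_rpow (F x y) p = 0"
        by (subst (asm) nn_integral_0_iff_AE) auto
      then show ?thesis by simp
    qed simp
  qed
  then have zero: "AE x in N. AE y in M. G y = 0 \<longrightarrow> F x y = 0"
    by (subst P.AE_commute) measurable
  show ?thesis
  proof (cases "\<integral>\<^sup>+y. G y \<partial>M")
    case (real A)
    then have fin: "AE y in M. G y < \<infinity>"
      using nn_integral_PInf_AE[of G M] by (simp add: less_top)
    show ?thesis
    proof (cases "A = 0")
      \<comment> \<open>The weighted inequality requires \<open>0 < A\<close>. If
        \<open>A = 0\<close>, then \<open>F\<close> vanishes almost everywhere and the left-hand
        side is 0.\<close>
      case True
      then have G0: "AE y in M. G y = 0"
        using real by (simp add: nn_integral_0_iff_AE)
      have "AE x in N. (\<integral>\<^sup>+y. F x y \<partial>M) = 0"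
        using zero
      proof eventually_elim
        case (elim x)
        with G0 have "AE y in M. F x y = 0" by eventually_elim simp
        then show ?case by (simp cong: nn_integral_cong_AE)
      qed
      then have "(\<integral>\<^sup>+x. ennreal_rpow (\<integral>\<^sup>+y. F x y \<partial>M) p \<partial>N) = (\<integral>\<^sup>+x. 0 \<partial>N)"
        by (intro nn_integral_cong_AE) auto
      then show ?thesis by simp
    next
      case False
      then have A: "0 < A" using real by auto
      have "(\<integral>\<^sup>+x. ennreal_rpow (\<integral>\<^sup>+y. F x y \<partial>M) p \<partial>N)
        \<le> (\<integral>\<^sup>+x. ennreal (A powr (p - 1)) * (\<integral>\<^sup>+y. ennreal_rpow (F x y) p * ennreal_rpow (G y) (1 - p) \<partial>M) \<partial>N)"
      proof (rule nn_integral_mono_AE)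
        show "AE x in N. ennreal_rpow (\<integral>\<^sup>+y. F x y \<partial>M) p
          \<le> ennreal (A powr (p - 1)) * (\<integral>\<^sup>+y. ennreal_rpow (F x y) p * ennreal_rpow (G y) (1 - p) \<partial>M)"
          using zero AE_space
        proof eventually_elim
          case (elim x)
          note [measurable] = elim(2)
          from elim(1) fin have "AE y in M. G y < \<infinity> \<and> (G y = 0 \<longrightarrow> F x y = 0)"
            by eventually_elim simp
          then show ?case
            using real A p by (intro hoelder_weighted) auto
        qed
      qed
      also have "\<dots> = ennreal (A powr (p - 1)) * (\<integral>\<^sup>+x. \<integral>\<^sup>+y. ennreal_rpow (F x y) p * ennreal_rpow (G y) (1 - p) \<partial>M \<partial>N)"
        by (intro nn_integral_cmult) measurable
      also have "(\<integral>\<^sup>+x. \<integral>\<^sup>+y. ennreal_rpow (F x y) p * ennreal_rpow (G y) (1 - p) \<partial>M \<partial>N)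
        = (\<integral>\<^sup>+y. \<integral>\<^sup>+x. ennreal_rpow (F x y) p * ennreal_rpow (G y) (1 - p) \<partial>N \<partial>M)"
        by (intro P.Fubini'[symmetric]) measurable
      also have "\<dots> = (\<integral>\<^sup>+y. ennreal_rpow (G y) p * ennreal_rpow (G y) (1 - p) \<partial>M)"
        by (intro nn_integral_cong) (simp add: nn_integral_multc Gp)
      also have "\<dots> = (\<integral>\<^sup>+y. G y \<partial>M)"
      proof (rule nn_integral_cong_AE)
        show "AE y in M. ennreal_rpow (G y) p * ennreal_rpow (G y) (1 - p) = G y"
          using fin
        proof eventually_elim
          case (elim y)
          then show ?case
            by (cases "G y") (auto simp flip: ennreal_mult powr_add)
        qed
      qed
      also have "ennreal (A powr (p - 1)) * \<dots> = ennreal (A powr p)"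
        using A real by (simp add: powr_diff flip: ennreal_mult)
      finally have "ennreal_rpow (\<integral>\<^sup>+x. ennreal_rpow (\<integral>\<^sup>+y. F x y \<partial>M) p \<partial>N) (1 / p) \<le> ennreal_rpow (ennreal (A powr p)) (1 / p)"
        using p by (intro ennreal_rpow_mono) auto
      also have "\<dots> = ennreal A"
        using A by (simp add: powr_powr)
      finally show ?thesis using real by (simp add: G_def)
    qed
  qed (simp add: G_def)
qed

section \<open>Radial functions and null sets\<close>

text \<open>Lebesgue measure is a constant multiple of its image under a dilation, so dilations
  preserve null sets.\<close>

lemma AE_lborel_scaleR:
  fixes P :: "'a::euclidean_space \<Rightarrow> bool"
  assumes "AE y in lborel. P y" and "c \<noteq> 0"
  shows "AE y in lborel. P (c *\<^sub>R y)"
proof -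
  have "AE y in distr lborel borel (\<lambda>x. 0 + c *\<^sub>R x). P y"
    using assms(1) by (subst (asm) lborel_affine[OF assms(2), of 0], subst (asm) AE_density) (auto simp: assms(2))
  then show ?thesis
    using AE_distrD[of "\<lambda>x. 0 + c *\<^sub>R x" lborel borel P] by simp
qed

lemma AE_lborel_imp_ex:
  fixes P :: "'a::euclidean_space \<Rightarrow> bool"
  assumes "AE y in lborel. P y" "emeasure lborel A \<noteq> 0" "A \<in> sets borel"
  shows "\<exists>y\<in>A. P y"
proof (rule ccontr)
  assume "\<not> ?thesis"
  with assms(1) have "AE y in lborel. y \<notin> A"
    by (auto elim: eventually_mono)
  then show False
    using assms by (simp add: AE_iff_null_sets[symmetric] null_sets_def)
qed

text \<open>
  Fubini's theorem on \<open>(t, y)\<close> for the dilates \<open>t \<psi>(y)\<close> replaces integration in polar coordinates here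
  and in \<open>radial_ex_borel\<close>.
\<close>

lemma AE_lborel_homogeneous:
  fixes \<psi> :: "'a::euclidean_space \<Rightarrow> real" and P :: "real \<Rightarrow> bool"
  assumes [measurable]: "\<psi> \<in> borel_measurable borel"
    and nz: "\<And>y. y \<noteq> 0 \<Longrightarrow> \<psi> y \<noteq> 0"
    and hom: "\<And>t. 0 < t \<Longrightarrow> \<exists>c. c \<noteq> 0 \<and> (\<forall>y. \<psi> (c *\<^sub>R y) = t * \<psi> y)"
    and P: "AE r in lborel. P r"
  shows "AE y in lborel. P (\<psi> y)"
proof -
  \<comment> \<open>A Borel null set containing the exceptional set makes the predicate on pairs
    measurable, as Fubini requires.\<close>
  obtain Z where Z: "{r. \<not> P r} \<subseteq> Z" and Z0: "emeasure lborel Z = 0" and [measurable]: "Z \<in> sets borel"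
    using P by (auto elim: AE_E)
  have notin: "AE r in lborel. r \<notin> Z"
    using Z0 by (intro AE_not_in) (auto simp: null_sets_def)
  \<comment> \<open>For fixed \<open>y\<close> other than 0, multiplication by
    \<open>\<psi> y\<close> is a nondegenerate dilation of the line.\<close>
  have "AE y in lborel. AE t in lborel. t * \<psi> y \<notin> Z"
    using AE_lborel_singleton[of 0]
  proof eventually_elim
    case (elim y)
    show ?case
      using AE_lborel_scaleR[OF notin nz[OF elim]] by (simp add: mult.commute)
  qed
  then have "AE t in lborel. AE y in lborel. t * \<psi> y \<notin> Z"
    by (subst lborel_pair.AE_commute) measurable
  \<comment> \<open>Choosing \<open>t\<close> in an interval of positive measure secures
    \<open>0 < t\<close>, which homogeneity asks for.\<close>
  then have "\<exists>t\<in>{0<..<1}. AE y in lborel. t * \<psi> y \<notin> Z"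
    by (rule AE_lborel_imp_ex) auto
  then obtain t where t: "0 < t" "AE y in lborel. t * \<psi> y \<notin> Z"
    by auto
  obtain c where c: "c \<noteq> 0" "\<And>y. \<psi> (c *\<^sub>R y) = t * \<psi> y"
    using hom[OF t(1)] by auto
  \<comment> \<open>Dilating \<open>y\<close> by the inverse of \<open>c\<close> cancels the factor
    \<open>t\<close>.\<close>
  have "AE y in lborel. t * \<psi> (inverse c *\<^sub>R y) \<notin> Z"
    using c(1) by (intro AE_lborel_scaleR[OF t(2)]) simp
  moreover have "t * \<psi> (inverse c *\<^sub>R y) = \<psi> y" for y
    using c(1) by (simp flip: c(2))
  ultimately have "AE y in lborel. \<psi> y \<notin> Z"
    by simp
  then show ?thesis
    using Z by (auto elim: eventually_mono)
qed

text \<open>Serves to carry finiteness at almost every radius over to almost every point.\<close>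

lemma AE_lborel_norm:
  assumes "AE r in lborel. P r"
  shows "AE y::'a::euclidean_space in lborel. P (norm y)"
proof (rule AE_lborel_homogeneous)
  show "\<exists>c. c \<noteq> 0 \<and> (\<forall>y::'a. norm (c *\<^sub>R y) = t * norm y)" if "0 < t" for t
    using that by (intro exI[of _ t]) auto
qed (use assms in auto)

text \<open>Ensures that, for a fixed radius \<open>r\<close>, the bad radii of a profile are hit by
  \<open>r / norm y\<close> only for a null set of \<open>y\<close>.\<close>

lemma AE_lborel_divide_norm:
  assumes "AE r in lborel. P r" "0 < r"
  shows "AE y::'a::euclidean_space in lborel. P (r / norm y)"
proof (rule AE_lborel_homogeneous)
  \<comment> \<open>The function is homogeneous of degree -1, hence the inverse of \<open>t\<close>
    as dilation factor.\<close>
  show "\<exists>c. c \<noteq> 0 \<and> (\<forall>y::'a. r / norm (c *\<^sub>R y) = t * (r / norm y))" if "0 < t" for t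
    using that by (intro exI[of _ "inverse t"]) (auto simp: field_simps)
qed (use assms in auto)

section \<open>Borel representatives\<close>

lemma borel_measurable_lebesgue_ex_borel:
  fixes f :: "'a::euclidean_space \<Rightarrow> complex"
  assumes "f \<in> borel_measurable lebesgue"
  shows "\<exists>g\<in>borel_measurable borel. AE x in lborel. f x = g x"
proof -
  have "(\<lambda>x. Re (f x)) \<in> borel_measurable lebesgue" "(\<lambda>x. Im (f x)) \<in> borel_measurable lebesgue"
    using assms by auto
  from this[THEN completion_ex_borel_measurable_real]
  obtain u v where uv: "u \<in> borel_measurable lborel" "AE x in lborel. Re (f x) = u x"
      "v \<in> borel_measurable lborel" "AE x in lborel. Im (f x) = v x"
    by (elim bexE)
  have "(\<lambda>x. Complex (u x) (v x)) \<in> borel_measurable borel"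
    using uv by (simp add: borel_measurable_complex_iff)
  moreover have "AE x in lborel. f x = Complex (u x) (v x)"
    using uv(2,4) by eventually_elim (simp add: complex_eq_iff)
  ultimately show ?thesis by (intro bexI)
qed

text \<open>The profile is a Borel version of \<open>f\<close> read along one ray. By Fubini some
  ray meets the exceptional null set in a null set of parameters, and radiality spreads the
  agreement on the ray to whole spheres, which is what angular integrals see.\<close>

lemma radial_ex_borel:
  fixes f :: "real ^ 'n \<Rightarrow> complex"
  assumes f: "f \<in> borel_measurable lebesgue" and rad: "radial f"
  shows "\<exists>g\<in>borel_measurable borel. AE r in lborel. \<forall>x. norm x = r \<longrightarrow> f x = g r"
proof -
  obtain f' where f'[measurable]: "f' \<in> borel_measurable borel" and ae: "AE x in lborel. f x = f' x"
    using borel_measurable_lebesgue_ex_borel[OF f] by auto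
  obtain Z where Z: "{x. f x \<noteq> f' x} \<subseteq> Z" and Z0: "emeasure lborel Z = 0" and [measurable]: "Z \<in> sets borel"
    using ae by (auto elim: AE_E)
  have notin: "AE x in lborel. x \<notin> Z"
    using Z0 by (intro AE_not_in) (auto simp: null_sets_def)
  have "AE t::real in lborel. AE y in lborel. t *\<^sub>R y \<notin> Z"
    using AE_lborel_singleton[of 0] by eventually_elim (rule AE_lborel_scaleR[OF notin])
  then have "AE y in lborel. AE t::real in lborel. t *\<^sub>R y \<notin> Z"
    by (subst lborel_pair.AE_commute) measurable
  then have "AE y in lborel. y \<noteq> 0 \<and> (AE t::real in lborel. t *\<^sub>R y \<notin> Z)"
    using AE_lborel_singleton[of 0] by eventually_elim simp
  then have "\<exists>y\<in>UNIV. y \<noteq> 0 \<and> (AE t::real in lborel. t *\<^sub>R y \<notin> Z)"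
    by (rule AE_lborel_imp_ex) auto
  then obtain y where y: "y \<noteq> 0" "AE t::real in lborel. t *\<^sub>R y \<notin> Z"
    by auto
  \<comment> \<open>The ray is reparametrised so that its positive parameter is the norm.\<close>
  have "AE r::real in lborel. (inverse (norm y) * r) *\<^sub>R y \<notin> Z"
    using AE_lborel_scaleR[OF y(2), of "inverse (norm y)"] y(1) by simp
  then have "AE r in lborel. \<forall>x. norm x = r \<longrightarrow> f x = f' ((inverse (norm y) * r) *\<^sub>R y)"
  proof eventually_elim
    case (elim r)
    show ?case
    proof (intro allI impI)
      fix x :: "real ^ 'n" assume "norm x = r"
      moreover have "norm ((inverse (norm y) * norm x) *\<^sub>R y) = norm x"
        using y(1) by simp
      ultimately have "f x = f ((inverse (norm y) * r) *\<^sub>R y)"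
        using rad unfolding radial_def by metis
      then show "f x = f' ((inverse (norm y) * r) *\<^sub>R y)"
        using elim Z by auto
    qed
  qed
  then show ?thesis
    by (rule bexI[where x = "\<lambda>r. f' ((inverse (norm y) * r) *\<^sub>R y)"]) measurable
qed

section \<open>Area of the unit sphere and measurability for completions\<close>

lemma space_sphere_measure [simp]: "space (sphere_measure :: (real ^ 'n) measure) = sphere 0 1"
  by (simp add: sphere_measure_def space_scale_measure space_restrict_space)

lemma emeasure_sphere_measure:
  "emeasure (sphere_measure :: (real ^ 'n) measure) (sphere 0 1)
    = of_nat CARD('n) * emeasure lborel (ball (0 :: real ^ 'n) 1)"
proof -
  let ?B = "ball (0 :: real ^ 'n) 1 - {0}" and ?S = "sphere (0 :: real ^ 'n) 1"
  let ?D = "distr (restrict_space lborel ?B) (restrict_space borel ?S) (\<lambda>x. x /\<^sub>R norm x)"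
  have meas: "(\<lambda>x. x /\<^sub>R norm x) \<in> restrict_space lborel ?B \<rightarrow>\<^sub>M restrict_space borel ?S"
  proof (rule measurable_restrict_space2)
    have "(\<lambda>x::real ^ 'n. x /\<^sub>R norm x) \<in> borel_measurable lborel" by measurable
    then show "(\<lambda>x. x /\<^sub>R norm x) \<in> restrict_space lborel ?B \<rightarrow>\<^sub>M borel"
      by (rule measurable_restrict_space1)
  qed (simp add: space_restrict_space Pi_iff)
  have S: "?S \<in> sets (restrict_space borel ?S)"
    using sets.top[of "restrict_space borel ?S"] by (simp add: space_restrict_space)
  have "emeasure ?D ?S = emeasure (restrict_space lborel ?B) ((\<lambda>x. x /\<^sub>R norm x) -` ?S \<inter> space (restrict_space lborel ?B))"
    by (rule emeasure_distr[OF meas S])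
  also have "(\<lambda>x. x /\<^sub>R norm x) -` ?S \<inter> space (restrict_space lborel ?B) = ?B"
    by (auto simp: space_restrict_space)
  also have "emeasure (restrict_space lborel ?B) ?B = emeasure lborel ?B"
    by (rule emeasure_restrict_space) auto
  also have "\<dots> = emeasure lborel (ball (0 :: real ^ 'n) 1)"
    by (rule emeasure_Diff_null_set) auto
  finally show ?thesis
    unfolding sphere_measure_def emeasure_scale_measure by simp
qed

text \<open>Powers of the area occur in the final constant both as a factor and as a divisor, so it
  has to be positive and finite.\<close>

lemma sphere_measure_area_ex:
  obtains \<omega> where "0 < \<omega>" "emeasure (sphere_measure :: (real ^ 'n) measure) (sphere 0 1) = ennreal \<omega>"
proof
  let ?b = "unit_ball_vol (real CARD('n))"
  show "0 < real CARD('n) * ?b"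
    by (simp add: unit_ball_vol_pos)
  show "emeasure (sphere_measure :: (real ^ 'n) measure) (sphere 0 1) = ennreal (real CARD('n) * ?b)"
    by (simp add: emeasure_sphere_measure emeasure_ball ennreal_mult ennreal_of_nat_eq_real_of_nat)
qed

text \<open>Preimages under \<open>f\<close> and \<open>g\<close> differ by subsets of a null set,
  and these are measurable in the completion.\<close>

lemma AE_imp_measurable_completion:
  assumes ae: "AE x in M. f x = g x" and [measurable]: "g \<in> M \<rightarrow>\<^sub>M N"
    and f: "f \<in> space M \<rightarrow> space N"
  shows "f \<in> completion M \<rightarrow>\<^sub>M N"
proof (rule measurableI)
  fix A assume [measurable]: "A \<in> sets N"
  have [measurable]: "g \<in> completion M \<rightarrow>\<^sub>M N"
    by (rule measurable_completion) measurable
  have [measurable]: "Measurable.pred (completion M) (\<lambda>x. f x \<noteq> g x)"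
    using ae by (intro sets_completion_AE) simp
  have [measurable]: "Measurable.pred (completion M) (\<lambda>x. f x \<noteq> g x \<and> f x \<in> A)"
    using ae by (intro sets_completion_AE) (auto elim: eventually_mono)
  have "f -` A \<inter> space (completion M)
    = {x \<in> space (completion M). g x \<in> A \<and> \<not> f x \<noteq> g x \<or> f x \<noteq> g x \<and> f x \<in> A}"
    by auto
  also have "\<dots> \<in> sets (completion M)"
    by measurable
  finally show "f -` A \<inter> space (completion M) \<in> sets (completion M)" .
qed (use f in auto)

section \<open>Herz norms of radial functions\<close>

text \<open>Turns the sum over shells into an integral for counting measure, to which Minkowski's
  inequality applies. The infinite sum is the supremum over finite sets.\<close>

lemma infsum_int_eq_nn_integral:
  fixes f :: "int \<Rightarrow> ennreal"
  shows "(\<Sum>\<^sub>\<infinity>k\<in>UNIV. f k) = (\<integral>\<^sup>+k. f k \<partial>count_space UNIV)"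
proof -
  have sup: "(\<Sum>\<^sub>\<infinity>k\<in>UNIV. f k) = (SUP F\<in>{F. finite F}. sum f F)"
    by (subst nonneg_infsum_complete) auto
  have sum: "sum f F = (\<integral>\<^sup>+k. f k * indicator F k \<partial>count_space UNIV)" if "finite F" for F
    using that by (subst nn_integral_count_space'[where A = F]) auto
  show ?thesis
  proof (rule antisym)
    show "(\<Sum>\<^sub>\<infinity>k\<in>UNIV. f k) \<le> (\<integral>\<^sup>+k. f k \<partial>count_space UNIV)"
      unfolding sup by (intro SUP_least) (auto simp: sum indicator_def intro!: nn_integral_mono)
    \<comment> \<open>Symmetric intervals exhaust the integers, and monotone convergence reduces the
      integral to finite sums.\<close>
    have "(\<integral>\<^sup>+k. f k \<partial>count_space UNIV) = (\<integral>\<^sup>+k. (SUP i. f k * indicator {- int i..int i} k) \<partial>count_space UNIV)"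
    proof (intro nn_integral_cong antisym)
      show "f k \<le> (SUP i. f k * indicator {- int i..int i} k)" for k
        by (rule SUP_upper2[of "nat \<bar>k\<bar>"]) (auto simp: indicator_def)
    qed (auto intro!: SUP_least simp: indicator_def)
    also have "\<dots> = (SUP i. \<integral>\<^sup>+k. f k * indicator {- int i..int i} k \<partial>count_space UNIV)"
      by (intro nn_integral_monotone_convergence_SUP) (auto simp: incseq_def le_fun_def indicator_def)
    also have "\<dots> = (SUP i. sum f {- int i..int i})"
      by (simp add: sum)
    also have "\<dots> \<le> (\<Sum>\<^sub>\<infinity>k\<in>UNIV. f k)"
      unfolding sup by (intro SUP_least SUP_upper) auto
    finally show "(\<integral>\<^sup>+k. f k \<partial>count_space UNIV) \<le> (\<Sum>\<^sub>\<infinity>k\<in>UNIV. f k)" .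
  qed
qed

section \<open>Norms of radial profiles\<close>

text \<open>The cut-off to the shell and the polar density are absorbed into the measure, which
  makes the radial norm a plain \<open>p\<close>-norm.\<close>

definition shell_measure :: "nat \<Rightarrow> int \<Rightarrow> real measure" where
  "shell_measure n k =
     density lborel (\<lambda>r. ennreal (indicator {2 powr (of_int k - 1)<..2 powr (of_int k)} r * r ^ (n - 1)))"

text \<open>Profiles take values in \<open>ennreal\<close> because the majorant of the operator may
  be infinite at some radii.\<close>

definition shell_norm :: "nat \<Rightarrow> real \<Rightarrow> int \<Rightarrow> (real \<Rightarrow> ennreal) \<Rightarrow> ennreal" where
  "shell_norm n p k u = ennreal_rpow (\<integral>\<^sup>+r. ennreal_rpow (u r) p \<partial>shell_measure n k) (1 / p)"

text \<open>The dyadic weight stands inside the \<open>q\<close>-th power, so this is a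
  \<open>q\<close>-norm for counting measure and Minkowski's inequality fits.\<close>

definition radial_herz_norm :: "nat \<Rightarrow> real \<Rightarrow> real \<Rightarrow> real \<Rightarrow> (real \<Rightarrow> ennreal) \<Rightarrow> ennreal" where
  "radial_herz_norm n \<alpha> q p u =
     ennreal_rpow (\<integral>\<^sup>+k. ennreal_rpow (ennreal (2 powr (of_int k * \<alpha>)) * shell_norm n p k u) q
       \<partial>count_space UNIV) (1 / q)"

lemma sets_shell_measure [measurable_cong, simp]: "sets (shell_measure n k) = sets borel"
  by (simp add: shell_measure_def)

lemma space_shell_measure [simp]: "space (shell_measure n k) = UNIV"
  by (simp add: shell_measure_def)

lemma sigma_finite_shell_measure: "sigma_finite_measure (shell_measure n k)"
  unfolding shell_measure_def by (subst sigma_finite_measure.sigma_finite_iff_density_finite[OF sigma_finite_lborel]) auto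

lemma nn_integral_shell_measure:
  assumes [measurable]: "f \<in> borel_measurable borel"
  shows "(\<integral>\<^sup>+r. f r \<partial>shell_measure n k)
    = (\<integral>\<^sup>+r. indicator {2 powr (of_int k - 1)<..2 powr (of_int k)} r * ennreal (r ^ (n - 1)) * f r \<partial>lborel)"
  unfolding shell_measure_def
  by (subst nn_integral_density) (auto intro!: nn_integral_cong simp: indicator_def)

lemma shell_norm_mono:
  assumes "0 \<le> p" "\<And>r. u r \<le> v r"
  shows "shell_norm n p k u \<le> shell_norm n p k v"
  unfolding shell_norm_def using assms by (intro ennreal_rpow_mono nn_integral_mono) auto

lemma shell_norm_cmult:
  assumes [measurable]: "u \<in> borel_measurable borel" and "p \<noteq> 0"
  shows "shell_norm n p k (\<lambda>r. c * u r) = c * shell_norm n p k u"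
  using assms(2) by (simp add: shell_norm_def ennreal_rpow_mult nn_integral_cmult ennreal_rpow_rpow)

lemma shell_norm_borel_measurable:
  assumes [measurable]: "case_prod u \<in> borel_measurable (M \<Otimes>\<^sub>M borel)"
  shows "(\<lambda>y. shell_norm n p k (u y)) \<in> borel_measurable M"
proof -
  interpret sigma_finite_measure "shell_measure n k" by (rule sigma_finite_shell_measure)
  show ?thesis unfolding shell_norm_def by measurable
qed

lemma radial_herz_norm_mono:
  assumes "0 \<le> p" "0 \<le> q" "\<And>r. u r \<le> v r"
  shows "radial_herz_norm n \<alpha> q p u \<le> radial_herz_norm n \<alpha> q p v"
  unfolding radial_herz_norm_def using assms
  by (intro ennreal_rpow_mono nn_integral_mono mult_left_mono shell_norm_mono) auto

text \<open>The factor stands outside the shell norms, the shape that arises both after Minkowski's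
  inequality (\<open>c = K y\<close>) and when a power of the area is pulled out.\<close>

lemma radial_herz_norm_cmult_shell:
  assumes "q \<noteq> 0"
  shows "ennreal_rpow (\<integral>\<^sup>+k. ennreal_rpow (ennreal (2 powr (of_int k * \<alpha>)) * (c * shell_norm n p k u)) q
       \<partial>count_space UNIV) (1 / q) = c * radial_herz_norm n \<alpha> q p u"
  using assms
  by (simp add: radial_herz_norm_def mult.left_commute[of _ c] ennreal_rpow_mult[of c] nn_integral_cmult
      ennreal_rpow_mult[of "ennreal_rpow c q"] ennreal_rpow_rpow)

section \<open>Dilations of profiles\<close>

text \<open>Substituting \<open>r = s * t\<close> produces \<open>s ^ n\<close>. Since
  \<open>s\<close> is known up to a factor 2, the values of \<open>t\<close> spread over two
  adjacent shells.\<close>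

lemma shell_norm_dilation:
  assumes u [measurable]: "u \<in> borel_measurable borel" and p: "1 \<le> p" and n: "1 \<le> n"
    and s: "2 powr (of_int m - 1) < s" "s \<le> 2 powr (of_int m)"
  shows "shell_norm n p k (\<lambda>r. u (r / s))
    \<le> ennreal (2 powr (1 / p) * s powr (real n / p)) * (shell_norm n p (k - m) u + shell_norm n p (k - m + 1) u)"
proof -
  have s0: "0 < s" using s(1) by (rule le_less_trans[rotated]) simp
  let ?i = "\<lambda>k r. indicator {2 powr (of_int k - 1)<..2 powr (of_int k)} r :: ennreal"
  let ?U = "\<lambda>r. ennreal_rpow (u r) p"
  let ?J = "\<lambda>k. \<integral>\<^sup>+r. ?U r \<partial>shell_measure n k"
  have sn: "s ^ n = s * s ^ (n - 1)"
    using n by (cases n) auto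
  \<comment> \<open>The bounds on \<open>s\<close> put \<open>t\<close> between
    \<open>2 powr (k - m - 1)\<close>, excluded, and \<open>2 powr (k - m + 1)\<close>, included:
    exactly the shells \<open>k - m\<close> and \<open>k - m + 1\<close>.\<close>
  have split: "?i k (s * t) \<le> ?i (k - m) t + ?i (k - m + 1) t" for t
  proof (cases "s * t \<in> {2 powr (of_int k - 1)<..2 powr (of_int k)}")
    case True
    have "2 powr (of_int m) * 2 powr (of_int k - of_int m - 1) = 2 powr (of_int k - 1 :: real)"
      by (simp flip: powr_add)
    also have "\<dots> < s * t" using True by simp
    finally have 1: "2 powr (of_int m) * 2 powr (of_int k - of_int m - 1) < s * t" .
    have t0: "0 < t"
      using True s0 by (metis greaterThanAtMost_iff less_trans powr_gt_zero zero_less_mult_pos zero_neq_numeral)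
    have "s * t \<le> 2 powr (of_int m) * t" using s(2) t0 by simp
    with 1 have lower: "2 powr (of_int k - of_int m - 1) < t"
      by (metis less_le_trans mult_less_cancel_left_pos powr_gt_zero zero_neq_numeral)
    have "2 powr (of_int m - 1) * t \<le> s * t" using s(1) t0 by simp
    also have "\<dots> \<le> 2 powr (of_int k)" using True by simp
    also have "\<dots> = 2 powr (of_int m - 1) * 2 powr (of_int k - of_int m + 1 :: real)"
      by (simp flip: powr_add)
    finally have "t \<le> 2 powr (of_int k - of_int m + 1)"
      by (rule mult_left_le_imp_le) simp
    with lower show ?thesis
      by (auto simp: indicator_def)
  qed (simp add: indicator_def)
  have "(\<integral>\<^sup>+r. ?U (r / s) \<partial>shell_measure n k)
      = (\<integral>\<^sup>+r. ?i k r * ennreal (r ^ (n - 1)) * ?U (r / s) \<partial>lborel)"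
    by (subst nn_integral_shell_measure) auto
  \<comment> \<open>The Jacobian contributes one factor \<open>s\<close>; the density contributes
    the other \<open>n - 1\<close>.\<close>
  also have "\<dots> = ennreal s * (\<integral>\<^sup>+t. ?i k (s * t) * ennreal ((s * t) ^ (n - 1)) * ?U t \<partial>lborel)"
    using s0 by (subst nn_integral_real_affine[where c = s and t = 0]) auto
  also have "\<dots> = ennreal s * (\<integral>\<^sup>+t. ennreal (s ^ (n - 1)) * (?i k (s * t) * ennreal (t ^ (n - 1)) * ?U t) \<partial>lborel)"
    using s0 ennreal_mult'[of "s ^ (n - 1)" "_ ^ (n - 1)"]
    by (simp add: power_mult_distrib mult.assoc mult.left_commute[of "ennreal (s ^ _)"])
  also have "\<dots> = ennreal s * (ennreal (s ^ (n - 1)) * (\<integral>\<^sup>+t. ?i k (s * t) * ennreal (t ^ (n - 1)) * ?U t \<partial>lborel))"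
    by (subst nn_integral_cmult) auto
  also have "\<dots> = ennreal (s ^ n) * (\<integral>\<^sup>+t. ?i k (s * t) * ennreal (t ^ (n - 1)) * ?U t \<partial>lborel)"
    using s0 by (simp add: sn ennreal_mult' mult.assoc)
  finally have scaled: "(\<integral>\<^sup>+r. ?U (r / s) \<partial>shell_measure n k)
      = ennreal (s ^ n) * (\<integral>\<^sup>+t. ?i k (s * t) * ennreal (t ^ (n - 1)) * ?U t \<partial>lborel)" .
  have "(\<integral>\<^sup>+t. ?i k (s * t) * ennreal (t ^ (n - 1)) * ?U t \<partial>lborel)
      \<le> (\<integral>\<^sup>+t. ?i (k - m) t * ennreal (t ^ (n - 1)) * ?U t + ?i (k - m + 1) t * ennreal (t ^ (n - 1)) * ?U t \<partial>lborel)"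
    unfolding distrib_right[symmetric] by (intro nn_integral_mono mult_right_mono split) auto
  also have "\<dots> = ?J (k - m) + ?J (k - m + 1)"
    by (subst (1 2) nn_integral_shell_measure) (auto intro!: nn_integral_add)
  finally have "(\<integral>\<^sup>+r. ?U (r / s) \<partial>shell_measure n k) \<le> ennreal (s ^ n) * (?J (k - m) + ?J (k - m + 1))"
    unfolding scaled by (rule mult_left_mono) simp
  then have "shell_norm n p k (\<lambda>r. u (r / s)) \<le> ennreal_rpow (ennreal (s ^ n) * (?J (k - m) + ?J (k - m + 1))) (1 / p)"
    unfolding shell_norm_def using p by (intro ennreal_rpow_mono) auto
  also have "\<dots> = ennreal (s powr (n / p)) * ennreal_rpow (?J (k - m) + ?J (k - m + 1)) (1 / p)"
    using s0 by (simp add: ennreal_rpow_mult powr_realpow[symmetric] powr_powr)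
  also have "\<dots> \<le> ennreal (s powr (n / p)) * (ennreal (2 powr (1 / p)) * (shell_norm n p (k - m) u + shell_norm n p (k - m + 1) u))"
    unfolding shell_norm_def using p by (intro mult_left_mono ennreal_rpow_add_le) auto
  also have "\<dots> = ennreal (2 powr (1 / p) * s powr (real n / p)) * (shell_norm n p (k - m) u + shell_norm n p (k - m + 1) u)"
    by (simp add: ennreal_mult' ac_simps)
  finally show ?thesis .
qed

text \<open>Needed for either sign of \<open>\<alpha>\<close> when dyadic weights are compared with
  powers of the dilation factor.\<close>

lemma powr_le_two_powr_abs:
  fixes x a :: real
  assumes "1 / 2 \<le> x" "x \<le> 2"
  shows "x powr a \<le> 2 powr \<bar>a\<bar>"
proof (cases "0 \<le> a")
  case True
  then show ?thesis using assms by (simp add: powr_mono2)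
next
  case False
  then have "x powr a = (1 / x) powr (- a)"
    using assms by (simp add: powr_divide powr_minus_divide)
  also have "\<dots> \<le> 2 powr (- a)"
    using assms False by (intro powr_mono2) (auto simp: field_simps)
  finally show ?thesis using False by simp
qed

lemma dyadic_shell_index_ex:
  fixes s :: real
  assumes "0 < s"
  obtains m :: int where "2 powr (of_int m - 1) < s" "s \<le> 2 powr (of_int m)"
proof
  have "s = 2 powr log 2 s" using assms by simp
  then show "2 powr (of_int \<lceil>log 2 s\<rceil> - 1) < s" "s \<le> 2 powr (of_int \<lceil>log 2 s\<rceil>)"
    by (metis ceiling_correct less_eq_real_def one_less_numeral_iff powr_less_cancel_iff powr_le_cancel_iff semiring_norm(76))+
qed

lemma nn_integral_count_space_int_shift:
  "(\<integral>\<^sup>+k. f (k + m) \<partial>count_space (UNIV :: int set)) = (\<integral>\<^sup>+k. f k \<partial>count_space UNIV)"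
  by (rule nn_integral_bij_count_space) (rule bij_betwI[of _ _ _ "\<lambda>k. k - m"], auto)

text \<open>In the constant, \<open>1 / p\<close> comes from splitting the shell norm,
  \<open>\<bar>\<alpha>\<bar>\<close> from comparing weights, 1 from splitting the
  \<open>q\<close>-th power of a sum, and \<open>1 / q\<close> from having two shifted copies of the
  same sum.\<close>

lemma radial_herz_norm_dilation:
  assumes u [measurable]: "u \<in> borel_measurable borel" and p: "1 \<le> p" and q: "1 \<le> q" and n: "1 \<le> n"
    and s: "0 < s"
  shows "radial_herz_norm n \<alpha> q p (\<lambda>r. u (r / s))
    \<le> ennreal (2 powr (1 / p + \<bar>\<alpha>\<bar> + 1 + 1 / q) * s powr (real n / p + \<alpha>)) * radial_herz_norm n \<alpha> q p u"
proof -
  obtain m where m: "2 powr (of_int m - 1) < s" "s \<le> 2 powr (of_int m)"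
    using dyadic_shell_index_ex[OF s] .
  define D where "D = 2 powr (1 / p + \<bar>\<alpha>\<bar>) * s powr (real n / p + \<alpha>)"
  have D0: "0 \<le> D" by (simp add: D_def)
  let ?b = "\<lambda>k. ennreal (2 powr (of_int k * \<alpha>)) * shell_norm n p k u"
  \<comment> \<open>Moving the weight from shell \<open>k\<close> to \<open>k - j\<close> costs
    \<open>2 powr (j * \<alpha>)\<close>, comparable to \<open>s powr \<alpha>\<close> because
    \<open>2 powr j\<close> and \<open>s\<close> differ by at most a factor 2.\<close>
  have weight: "2 powr (of_int k * \<alpha>) \<le> 2 powr \<bar>\<alpha>\<bar> * s powr \<alpha> * 2 powr (of_int (k - j) * \<alpha>)"
    if "1 / 2 \<le> 2 powr (of_int j) / s" "2 powr (of_int j) / s \<le> 2" for j k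
  proof -
    have "2 powr (of_int k * \<alpha>) = 2 powr (of_int j * \<alpha>) * 2 powr (of_int (k - j) * \<alpha>)"
      by (simp add: algebra_simps flip: powr_add)
    also have "2 powr (of_int j * \<alpha>) = (2 powr (of_int j) / s) powr \<alpha> * s powr \<alpha>"
      using s by (simp add: powr_divide powr_powr)
    also have "\<dots> \<le> 2 powr \<bar>\<alpha>\<bar> * s powr \<alpha>"
      using that by (intro mult_right_mono powr_le_two_powr_abs) auto
    finally show ?thesis by (simp add: mult_right_mono)
  qed
  have m2: "2 powr (of_int (m - 1)) = 2 powr (of_int m) / (2::real)"
    by (simp add: powr_diff)
  have w1: "2 powr (of_int k * \<alpha>) \<le> 2 powr \<bar>\<alpha>\<bar> * s powr \<alpha> * 2 powr (of_int (k - m) * \<alpha>)" for k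
    using m m2 s by (intro weight) (auto simp: field_simps)
  \<comment> \<open>The second shell \<open>k - m + 1\<close> corresponds to
    \<open>j = m - 1\<close>.\<close>
  have w2: "2 powr (of_int k * \<alpha>) \<le> 2 powr \<bar>\<alpha>\<bar> * s powr \<alpha> * 2 powr (of_int (k - m + 1) * \<alpha>)" for k
    using m m2 s weight[of "m - 1" k] by (auto simp: field_simps)
  have "ennreal (2 powr (of_int k * \<alpha>)) * shell_norm n p k (\<lambda>r. u (r / s)) \<le> ennreal D * (?b (k - m) + ?b (k - m + 1))" for k
  proof -
    let ?e = "ennreal (2 powr (1 / p) * s powr (real n / p))"
    have Ds: "ennreal D = ?e * ennreal (2 powr \<bar>\<alpha>\<bar> * s powr \<alpha>)"
      by (simp add: D_def powr_add flip: ennreal_mult')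
    have "ennreal (2 powr (of_int k * \<alpha>)) * shell_norm n p k (\<lambda>r. u (r / s))
        \<le> ennreal (2 powr (of_int k * \<alpha>)) * (?e * (shell_norm n p (k - m) u + shell_norm n p (k - m + 1) u))"
      by (intro mult_left_mono shell_norm_dilation[OF u p n m]) auto
    also have "\<dots> = ?e * (ennreal (2 powr (of_int k * \<alpha>)) * shell_norm n p (k - m) u
        + ennreal (2 powr (of_int k * \<alpha>)) * shell_norm n p (k - m + 1) u)"
      by (simp add: distrib_left ac_simps)
    also have "\<dots> \<le> ?e * (ennreal (2 powr \<bar>\<alpha>\<bar> * s powr \<alpha>) * ?b (k - m)
        + ennreal (2 powr \<bar>\<alpha>\<bar> * s powr \<alpha>) * ?b (k - m + 1))"
      unfolding mult.assoc[symmetric] ennreal_mult'[symmetric, OF powr_ge_zero]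
        ennreal_mult'[symmetric, OF mult_nonneg_nonneg[OF powr_ge_zero powr_ge_zero]]
      by (intro mult_left_mono add_mono mult_right_mono ennreal_leI w1 w2 zero_le)
    finally show ?thesis by (simp add: Ds distrib_left ac_simps)
  qed
  then have "radial_herz_norm n \<alpha> q p (\<lambda>r. u (r / s))
      \<le> ennreal_rpow (\<integral>\<^sup>+k. ennreal_rpow (ennreal D * (?b (k - m) + ?b (k - m + 1))) q \<partial>count_space UNIV) (1 / q)"
    unfolding radial_herz_norm_def using q by (intro ennreal_rpow_mono nn_integral_mono) auto
  also have "\<dots> \<le> ennreal_rpow (\<integral>\<^sup>+k. ennreal (D powr q * 2 powr q) *
      (ennreal_rpow (?b (k - m)) q + ennreal_rpow (?b (k - m + 1)) q) \<partial>count_space UNIV) (1 / q)"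
  proof (intro ennreal_rpow_mono nn_integral_mono)
    fix k
    have "ennreal_rpow (ennreal D * (?b (k - m) + ?b (k - m + 1))) q
      \<le> ennreal (D powr q) * (ennreal (2 powr q) * (ennreal_rpow (?b (k - m)) q + ennreal_rpow (?b (k - m + 1)) q))"
      unfolding ennreal_rpow_mult[of "ennreal D"] ennreal_rpow_ennreal[OF D0]
      using q by (intro mult_left_mono ennreal_rpow_add_le) auto
    then show "ennreal_rpow (ennreal D * (?b (k - m) + ?b (k - m + 1))) q
      \<le> ennreal (D powr q * 2 powr q) * (ennreal_rpow (?b (k - m)) q + ennreal_rpow (?b (k - m + 1)) q)"
      by (simp only: ennreal_mult'[OF powr_ge_zero] mult.assoc)
  qed (use q in auto)
  also have "(\<integral>\<^sup>+k. ennreal (D powr q * 2 powr q) *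
      (ennreal_rpow (?b (k - m)) q + ennreal_rpow (?b (k - m + 1)) q) \<partial>count_space UNIV)
    = ennreal (D powr q * 2 powr q) *
      ((\<integral>\<^sup>+k. ennreal_rpow (?b (k + (- m))) q \<partial>count_space UNIV)
       + (\<integral>\<^sup>+k. ennreal_rpow (?b (k + (1 - m))) q \<partial>count_space UNIV))"
    by (subst nn_integral_cmult) (simp_all add: nn_integral_add algebra_simps)
  \<comment> \<open>Both shifted sums over all integers equal the unshifted one, whence the last
    factor 2.\<close>
  also have "\<dots> = ennreal ((D * 2) powr q * 2) * (\<integral>\<^sup>+k. ennreal_rpow (?b k) q \<partial>count_space UNIV)"
    unfolding nn_integral_count_space_int_shift[where f = "\<lambda>k. ennreal_rpow (?b k) q"]
    using D0 by (simp add: mult_2[symmetric] powr_mult ennreal_mult' mult.assoc)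
  also have "ennreal_rpow \<dots> (1 / q) = ennreal (D * 2 * 2 powr (1 / q)) * radial_herz_norm n \<alpha> q p u"
    using D0 q by (simp add: ennreal_rpow_mult[of "ennreal _"] radial_herz_norm_def powr_mult powr_powr)
  also have "D * 2 * 2 powr (1 / q) = 2 powr (1 / p + \<bar>\<alpha>\<bar> + 1 + 1 / q) * s powr (real n / p + \<alpha>)"
    by (simp add: D_def powr_add)
  finally show ?thesis .
qed

text \<open>
  Minkowski's inequality is applied first in \<open>L\<^sup>p(r\<^sup>n\<^sup>-\<^sup>1 dr)\<close> on each shell and then in \<open>\<ell>\<^sup>q\<close> over the shells.
\<close>

lemma radial_herz_norm_hausdorff:
  fixes K :: "'a::euclidean_space \<Rightarrow> ennreal"
  assumes u [measurable]: "u \<in> borel_measurable borel" and K [measurable]: "K \<in> borel_measurable borel"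
    and p: "1 \<le> p" and q: "1 \<le> q" and n: "1 \<le> n"
  shows "radial_herz_norm n \<alpha> q p (\<lambda>r. \<integral>\<^sup>+y. K y * u (r / norm y) \<partial>lborel)
    \<le> ennreal (2 powr (1 / p + \<bar>\<alpha>\<bar> + 1 + 1 / q)) *
      (\<integral>\<^sup>+y. K y * ennreal (norm y powr (real n / p + \<alpha>)) \<partial>lborel) * radial_herz_norm n \<alpha> q p u"
proof -
  let ?I = "\<lambda>r. \<integral>\<^sup>+y. K y * u (r / norm y) \<partial>lborel"
  let ?a = "\<lambda>k y. shell_norm n p k (\<lambda>r. u (r / norm y))"
  let ?w = "\<lambda>k. ennreal (2 powr (of_int k * \<alpha>))"
  have [measurable]: "(\<lambda>y::'a. ?a k y) \<in> borel_measurable borel" for k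
    by (rule shell_norm_borel_measurable) measurable
  have shell: "shell_norm n p k ?I \<le> (\<integral>\<^sup>+y. K y * ?a k y \<partial>lborel)" for k
  proof -
    have "shell_norm n p k ?I \<le> (\<integral>\<^sup>+y. shell_norm n p k (\<lambda>r. K y * u (r / norm y)) \<partial>lborel)"
      unfolding shell_norm_def
      by (rule minkowski_integral_inequality[OF sigma_finite_shell_measure sigma_finite_lborel _ p]) measurable
    also have "\<dots> = (\<integral>\<^sup>+y. K y * ?a k y \<partial>lborel)"
      using p by (intro nn_integral_cong shell_norm_cmult) auto
    finally show ?thesis .
  qed
  have "radial_herz_norm n \<alpha> q p ?I
      \<le> ennreal_rpow (\<integral>\<^sup>+k. ennreal_rpow (\<integral>\<^sup>+y. ?w k * (K y * ?a k y) \<partial>lborel) q \<partial>count_space UNIV) (1 / q)"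
    unfolding radial_herz_norm_def using q shell
    by (intro ennreal_rpow_mono nn_integral_mono) (auto simp: nn_integral_cmult intro!: mult_left_mono)
  also have "\<dots> \<le> (\<integral>\<^sup>+y. ennreal_rpow (\<integral>\<^sup>+k. ennreal_rpow (?w k * (K y * ?a k y)) q \<partial>count_space UNIV) (1 / q) \<partial>lborel)"
    by (rule minkowski_integral_inequality[OF _ sigma_finite_lborel _ q])
       (auto intro!: sigma_finite_measure_count_space_countable measurable_pair_measure_countable1)
  also have "\<dots> = (\<integral>\<^sup>+y. K y * radial_herz_norm n \<alpha> q p (\<lambda>r. u (r / norm y)) \<partial>lborel)"
    using q by (intro nn_integral_cong radial_herz_norm_cmult_shell) auto
  \<comment> \<open>The dilation bound is applied for each \<open>y\<close> other than the origin,
    where the factor \<open>norm y\<close> is positive.\<close>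
  also have "\<dots> \<le> (\<integral>\<^sup>+y. ennreal (2 powr (1 / p + \<bar>\<alpha>\<bar> + 1 + 1 / q)) * (K y * ennreal (norm y powr (real n / p + \<alpha>)))
      * radial_herz_norm n \<alpha> q p u \<partial>lborel)"
  proof (rule nn_integral_mono_AE)
    show "AE y in lborel. K y * radial_herz_norm n \<alpha> q p (\<lambda>r. u (r / norm y))
      \<le> ennreal (2 powr (1 / p + \<bar>\<alpha>\<bar> + 1 + 1 / q)) * (K y * ennreal (norm y powr (real n / p + \<alpha>)))
        * radial_herz_norm n \<alpha> q p u"
      using AE_lborel_singleton[of 0]
    proof eventually_elim
      case (elim y)
      have "K y * radial_herz_norm n \<alpha> q p (\<lambda>r. u (r / norm y))
        \<le> K y * (ennreal (2 powr (1 / p + \<bar>\<alpha>\<bar> + 1 + 1 / q) * norm y powr (real n / p + \<alpha>)) * radial_herz_norm n \<alpha> q p u)"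
        using elim by (intro mult_left_mono radial_herz_norm_dilation[OF u p q n]) auto
      then show ?case
        by (simp add: ennreal_mult' ac_simps)
    qed
  qed
  also have "\<dots> = ennreal (2 powr (1 / p + \<bar>\<alpha>\<bar> + 1 + 1 / q)) *
      (\<integral>\<^sup>+y. K y * ennreal (norm y powr (real n / p + \<alpha>)) \<partial>lborel) * radial_herz_norm n \<alpha> q p u"
    by (simp add: nn_integral_multc nn_integral_cmult)
  finally show ?thesis .
qed

text \<open>A finite norm forces every shell norm to be finite, and countably many shells cover the
  positive half-line. Applied to the majorant, this gives absolute convergence of the Hausdorff
  integral.\<close>

lemma radial_herz_norm_finite_AE:
  assumes [measurable]: "u \<in> borel_measurable borel" and fin: "radial_herz_norm n \<alpha> q p u < \<infinity>"
  shows "AE r in lborel. 0 < r \<longrightarrow> u r < \<infinity>"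
proof -
  have "AE r in lborel. r \<in> {2 powr (of_int k - 1)<..2 powr (of_int k)} \<longrightarrow> u r < \<infinity>" for k :: int
  proof -
    have "(\<integral>\<^sup>+k. ennreal_rpow (ennreal (2 powr (of_int k * \<alpha>)) * shell_norm n p k u) q \<partial>count_space UNIV) \<noteq> \<infinity>"
      using fin by (auto simp: radial_herz_norm_def)
    then have "AE k in count_space UNIV. ennreal_rpow (ennreal (2 powr (of_int k * \<alpha>)) * shell_norm n p k u) q \<noteq> \<infinity>"
      by (rule nn_integral_PInf_AE[rotated]) simp
    then have "shell_norm n p k u \<noteq> \<infinity>"
      by (auto simp: AE_count_space ennreal_mult_eq_top_iff dest: spec[of _ k])
    then have "(\<integral>\<^sup>+r. ennreal_rpow (u r) p \<partial>shell_measure n k) \<noteq> \<infinity>"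
      by (auto simp: shell_norm_def)
    then have "AE r in shell_measure n k. ennreal_rpow (u r) p \<noteq> \<infinity>"
      by (rule nn_integral_PInf_AE[rotated]) measurable
    then have "AE r in lborel. 0 < ennreal (indicator {2 powr (of_int k - 1)<..2 powr (of_int k)} r * r ^ (n - 1)) \<longrightarrow> u r \<noteq> \<infinity>"
      unfolding shell_measure_def by (subst (asm) AE_density) auto
    then show ?thesis
    proof eventually_elim
      case (elim r)
      show ?case
      proof
        assume r: "r \<in> {2 powr (of_int k - 1)<..2 powr (of_int k)}"
        then have "0 < r" by (auto intro: less_trans[rotated])
        then show "u r < \<infinity>" using elim r by (simp add: less_top)
      qed
    qed
  qed
  then have "AE r in lborel. \<forall>k::int. r \<in> {2 powr (of_int k - 1)<..2 powr (of_int k)} \<longrightarrow> u r < \<infinity>"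
    by (subst AE_all_countable) (rule allI)
  then show ?thesis
  proof eventually_elim
    case (elim r)
    then show ?case
      using dyadic_shell_index_ex[of r] by (metis greaterThanAtMost_iff)
  qed
qed

section \<open>From functions on the whole space to profiles\<close>

text \<open>On each sphere the integrand is constant, so the angular integral contributes the factor
  \<open>\<omega>\<close>; the powers \<open>p2 / p1\<close> and \<open>1 / p2\<close> turn it into
  \<open>\<omega> powr (1 / p1)\<close>.\<close>

lemma rad_ang_norm_radial_shell:
  fixes f :: "real ^ 'n \<Rightarrow> complex"
  assumes v [measurable]: "v \<in> borel_measurable borel"
    and f: "AE r in lborel. 0 < r \<longrightarrow> (\<forall>x. norm x = r \<longrightarrow> ennreal (norm (f x)) = v r)"
    and \<omega>: "0 < \<omega>" "emeasure (sphere_measure :: (real ^ 'n) measure) (sphere 0 1) = ennreal \<omega>"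
    and p: "0 < p1" "0 < p2"
  shows "rad_ang_norm p2 p1 (\<lambda>x. f x * indicator (dyadic_shell k) x)
    = ennreal (\<omega> powr (1 / p1)) * shell_norm CARD('n) p2 k v"
proof -
  let ?A = "{2 powr (of_int k - 1)<..2 powr (of_int k)} :: real set"
  have A0: "0 < r" if "r \<in> ?A" for r
    using that by (auto intro: less_trans[rotated])
  have inner: "(\<integral>\<^sup>+\<theta>. ennreal (norm (f (r *\<^sub>R \<theta>) * indicator (dyadic_shell k) (r *\<^sub>R \<theta>)) powr p1) \<partial>sphere_measure)
      = indicator ?A r * ennreal_rpow (v r) p1 * ennreal \<omega>"
    if r: "0 < r" and fr: "\<forall>x. norm x = r \<longrightarrow> ennreal (norm (f x)) = v r" for r
  proof -
    have "(\<integral>\<^sup>+\<theta>. ennreal (norm (f (r *\<^sub>R \<theta>) * indicator (dyadic_shell k) (r *\<^sub>R \<theta>)) powr p1) \<partial>sphere_measure)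
        = (\<integral>\<^sup>+(\<theta> :: real ^ 'n). indicator ?A r * ennreal_rpow (v r) p1 \<partial>sphere_measure)"
    proof (rule nn_integral_cong)
      fix \<theta> :: "real ^ 'n" assume "\<theta> \<in> space sphere_measure"
      then have nr: "norm (r *\<^sub>R \<theta>) = r" using r by simp
      then have "ennreal (norm (f (r *\<^sub>R \<theta>)) powr p1) = ennreal_rpow (v r) p1"
        using fr[rule_format, OF nr, symmetric] by simp
      then show "ennreal (norm (f (r *\<^sub>R \<theta>) * indicator (dyadic_shell k) (r *\<^sub>R \<theta>)) powr p1)
          = indicator ?A r * ennreal_rpow (v r) p1"
        using nr by (auto simp: indicator_def dyadic_shell_def)
    qed
    then show ?thesis using \<omega> by simp
  qed
  have "(\<integral>\<^sup>+ r \<in> {0<..}.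
      (ennreal_rpow (\<integral>\<^sup>+ \<theta>. ennreal (norm (f (r *\<^sub>R \<theta>) * indicator (dyadic_shell k) (r *\<^sub>R \<theta>)) powr p1) \<partial>sphere_measure) (p2 / p1)
        * ennreal (r ^ (CARD('n) - 1))) \<partial>lborel)
    = (\<integral>\<^sup>+r. ennreal (\<omega> powr (p2 / p1)) * (indicator ?A r * ennreal (r ^ (CARD('n) - 1)) * ennreal_rpow (v r) p2) \<partial>lborel)"
  proof (rule nn_integral_cong_AE)
    show "AE r in lborel. ennreal_rpow (\<integral>\<^sup>+ \<theta>. ennreal (norm (f (r *\<^sub>R \<theta>) * indicator (dyadic_shell k) (r *\<^sub>R \<theta>)) powr p1) \<partial>sphere_measure) (p2 / p1)
        * ennreal (r ^ (CARD('n) - 1)) * indicator {0<..} r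
      = ennreal (\<omega> powr (p2 / p1)) * (indicator ?A r * ennreal (r ^ (CARD('n) - 1)) * ennreal_rpow (v r) p2)"
      using f
    proof eventually_elim
      case (elim r)
      show ?case
      proof (cases "r \<in> ?A")
        case True
        then show ?thesis
          using elim A0[OF True] p \<omega>(1)
          by (simp add: inner ennreal_rpow_mult ennreal_rpow_rpow ac_simps)
      next
        case False
        then show ?thesis
          using elim by (cases "0 < r") (simp_all add: inner)
      qed
    qed
  qed
  also have "\<dots> = ennreal (\<omega> powr (p2 / p1)) * (\<integral>\<^sup>+r. ennreal_rpow (v r) p2 \<partial>shell_measure CARD('n) k)"
    by (subst nn_integral_cmult) (auto simp: nn_integral_shell_measure)
  finally show ?thesis
    using p by (simp add: rad_ang_norm_def shell_norm_def ennreal_rpow_mult powr_powr)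
qed

text \<open>The angular exponent survives only in a power of \<open>\<omega>\<close>, so for radial
  functions changing it from \<open>p1'\<close> to \<open>p1\<close> costs a constant.\<close>

lemma herz_norm_radial:
  fixes f :: "real ^ 'n \<Rightarrow> complex"
  assumes "v \<in> borel_measurable borel"
    and "AE r in lborel. 0 < r \<longrightarrow> (\<forall>x. norm x = r \<longrightarrow> ennreal (norm (f x)) = v r)"
    and "0 < \<omega>" "emeasure (sphere_measure :: (real ^ 'n) measure) (sphere 0 1) = ennreal \<omega>"
    and "0 < p1" "0 < p2" and q: "0 < q"
  shows "herz_norm \<alpha> q p2 p1 f = ennreal (\<omega> powr (1 / p1)) * radial_herz_norm CARD('n) \<alpha> q p2 v"
proof -
  have "herz_norm \<alpha> q p2 p1 f
    = ennreal_rpow (\<integral>\<^sup>+k. ennreal_rpow (ennreal (2 powr (of_int k * \<alpha>)) *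
        (ennreal (\<omega> powr (1 / p1)) * shell_norm CARD('n) p2 k v)) q \<partial>count_space UNIV) (1 / q)"
    by (simp add: herz_norm_def rad_ang_norm_radial_shell[OF assms(1-6)] infsum_int_eq_nn_integral
        ennreal_rpow_mult[of "ennreal (2 powr _)"] powr_powr)
  then show ?thesis
    using q by (simp add: radial_herz_norm_cmult_shell)
qed

section \<open>The bound for the Hausdorff operator\<close>

text \<open>A Bochner integral is 0 by convention where the integrand is not integrable. The clause
  on integrability and measurability shows that, for a finite constant, the norm bound concerns a
  genuine integral at almost every point.\<close>

theorem theorem1p5:
  fixes \<alpha> p1 p2 p1' q :: real
  assumes "CARD('n::finite) \<ge> 2"
    and "1 \<le> p1" and "1 \<le> p2" and "1 \<le> p1'" and "1 \<le> q"
  shows "\<exists>C::real. C > 0 \<and>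
    (\<forall>(\<Phi> :: real ^ 'n \<Rightarrow> complex) (f :: real ^ 'n \<Rightarrow> complex).
       \<Phi> \<in> borel_measurable lebesgue \<longrightarrow> f \<in> herz_space \<alpha> q p2 p1' \<longrightarrow> radial f \<longrightarrow>
         (hausdorff_const (real CARD('n) / p2 + \<alpha>) \<Phi> < \<infinity> \<longrightarrow>
            (AE x in lebesgue. integrable lebesgue (hausdorff_integrand \<Phi> f x)) \<and>
            hausdorff_op \<Phi> f \<in> borel_measurable lebesgue) \<and>
         herz_norm \<alpha> q p2 p1 (hausdorff_op \<Phi> f)
           \<le> ennreal C * hausdorff_const (real CARD('n) / p2 + \<alpha>) \<Phi> * herz_norm \<alpha> q p2 p1' f)"
proof -
  let ?n = "CARD('n)"
  obtain \<omega> where \<omega>: "0 < \<omega>" "emeasure (sphere_measure :: (real ^ 'n) measure) (sphere 0 1) = ennreal \<omega>"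
    using sphere_measure_area_ex .
  define D where "D = 2 powr (1 / p2 + \<bar>\<alpha>\<bar> + 1 + 1 / q)"
  \<comment> \<open>\<open>D\<close> is the dilation constant; the powers of \<open>\<omega>\<close>
    convert profile norms to the angular exponent \<open>p1\<close> on the left and
    \<open>p1'\<close> on the right.\<close>
  define C where "C = \<omega> powr (1 / p1) * D / \<omega> powr (1 / p1')"
  have "C > 0" using \<omega>(1) by (simp add: C_def D_def)
  moreover have "(hausdorff_const (real ?n / p2 + \<alpha>) \<Phi> < \<infinity> \<longrightarrow>
            (AE x in lebesgue. integrable lebesgue (hausdorff_integrand \<Phi> f x)) \<and>
            hausdorff_op \<Phi> f \<in> borel_measurable lebesgue) \<and>
         herz_norm \<alpha> q p2 p1 (hausdorff_op \<Phi> f)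
           \<le> ennreal C * hausdorff_const (real ?n / p2 + \<alpha>) \<Phi> * herz_norm \<alpha> q p2 p1' f"
    if \<Phi>: "\<Phi> \<in> borel_measurable lebesgue" and f: "f \<in> herz_space \<alpha> q p2 p1'" and rad: "radial f"
    for \<Phi> f :: "real ^ 'n \<Rightarrow> complex"
  proof -
    \<comment> \<open>Borel versions of \<open>\<Phi>\<close> and of the profile of \<open>f\<close>
      make the integrands below jointly measurable in \<open>(r, y)\<close>.\<close>
    obtain \<Psi> where \<Psi> [measurable]: "\<Psi> \<in> borel_measurable borel" and \<Phi>\<Psi>: "AE y in lborel. \<Phi> y = \<Psi> y"
      using borel_measurable_lebesgue_ex_borel[OF \<Phi>] by (elim bexE)
    obtain g where g [measurable]: "g \<in> borel_measurable borel"
        and fg: "AE r in lborel. \<forall>x. norm x = r \<longrightarrow> f x = g r"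
      using radial_ex_borel[OF _ rad] f by (auto simp: herz_space_def)
    define K where "K y = ennreal (norm (\<Psi> y) / norm y ^ ?n)" for y
    define u where "u r = ennreal (norm (g r))" for r
    define J where "J r y = \<Psi> y / of_real (norm y ^ ?n) * g (r / norm y)" for r y
    define h where "h r = (\<integral>y. J r y \<partial>lborel)" for r
    define I where "I r = (\<integral>\<^sup>+y. K y * u (r / norm y) \<partial>lborel)" for r
    have [measurable]: "K \<in> borel_measurable borel" "u \<in> borel_measurable borel"
      unfolding K_def u_def by measurable
    have Jpair [measurable]: "case_prod J \<in> borel_measurable (borel \<Otimes>\<^sub>M lborel)"
      unfolding J_def by measurable
    have Jr [measurable]: "J r \<in> borel_measurable lborel" for r
      unfolding J_def by measurable
    have h [measurable]: "h \<in> borel_measurable borel"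
      unfolding h_def by measurable
    have I [measurable]: "I \<in> borel_measurable borel"
      unfolding I_def by measurable
    have normJ: "ennreal (norm (J r y)) = K y * u (r / norm y)" for r y
      by (simp add: J_def K_def u_def norm_mult norm_divide norm_power flip: ennreal_mult')
    \<comment> \<open>Valid for every \<open>r\<close>: where \<open>J r\<close> is not integrable,
      \<open>h r\<close> is 0 by convention.\<close>
    have hI: "ennreal (norm (h r)) \<le> I r" for r
    proof (cases "integrable lborel (J r)")
      case True
      then show ?thesis
        using integral_norm_bound_ennreal[OF True] by (simp add: h_def I_def normJ)
    qed (simp add: h_def not_integrable_integral_eq)
    \<comment> \<open>This holds for every \<open>x\<close> other than 0, not just almost every one,
      so the operator agrees with \<open>h (norm x)\<close> on entire spheres.\<close>
    have integrand: "AE y in lborel. hausdorff_integrand \<Phi> f x y = J (norm x) y" if "x \<noteq> 0" for x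
    proof -
      have "AE y in lborel. \<forall>z. norm z = norm x / norm (y :: real ^ 'n) \<longrightarrow> f z = g (norm x / norm y)"
        by (rule AE_lborel_divide_norm[OF fg]) (use that in simp)
      with \<Phi>\<Psi> show ?thesis
      proof eventually_elim
        case (elim y)
        then show ?case
          by (simp add: hausdorff_integrand_def J_def divide_inverse_commute)
      qed
    qed
    have integrand_measurable: "hausdorff_integrand \<Phi> f x \<in> borel_measurable lebesgue" if "x \<noteq> 0" for x
      by (rule AE_imp_measurable_completion[OF integrand[OF that]]) auto
    have op: "hausdorff_op \<Phi> f x = h (norm x)" if "x \<noteq> 0" for x
    proof -
      have "hausdorff_op \<Phi> f x = (\<integral>y. J (norm x) y \<partial>lebesgue)"
        unfolding hausdorff_op_def using that
        by (intro integral_cong_AE integrand_measurable AE_completion integrand measurable_completion Jr)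
      then show ?thesis by (simp add: h_def integral_completion)
    qed
    have const: "hausdorff_const (real ?n / p2 + \<alpha>) \<Phi> = (\<integral>\<^sup>+y. K y * ennreal (norm y powr (real ?n / p2 + \<alpha>)) \<partial>lborel)"
      unfolding hausdorff_const_def nn_integral_completion
    proof (rule nn_integral_cong_AE)
      show "AE y in lborel. ennreal (norm (\<Phi> y) / norm y ^ ?n * norm y powr (real ?n / p2 + \<alpha>))
          = K y * ennreal (norm y powr (real ?n / p2 + \<alpha>))"
        using \<Phi>\<Psi> by eventually_elim (simp add: K_def flip: ennreal_mult')
    qed
    have herz_f: "herz_norm \<alpha> q p2 p1' f = ennreal (\<omega> powr (1 / p1')) * radial_herz_norm ?n \<alpha> q p2 u"
    proof (rule herz_norm_radial)
      show "AE r in lborel. 0 < r \<longrightarrow> (\<forall>x. norm x = r \<longrightarrow> ennreal (norm (f x)) = u r)"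
        using fg by eventually_elim (simp add: u_def)
    qed (use assms \<omega> in auto)
    have herz_op: "herz_norm \<alpha> q p2 p1 (hausdorff_op \<Phi> f)
      = ennreal (\<omega> powr (1 / p1)) * radial_herz_norm ?n \<alpha> q p2 (\<lambda>r. ennreal (norm (h r)))"
    proof (rule herz_norm_radial)
      show "AE r in lborel. 0 < r \<longrightarrow> (\<forall>x. norm x = r \<longrightarrow> ennreal (norm (hausdorff_op \<Phi> f x)) = ennreal (norm (h r)))"
        by (intro AE_I2) (auto simp: op)
    qed (use assms \<omega> in auto)
    have bound: "radial_herz_norm ?n \<alpha> q p2 I
      \<le> ennreal D * hausdorff_const (real ?n / p2 + \<alpha>) \<Phi> * radial_herz_norm ?n \<alpha> q p2 u"
      unfolding const I_def D_def using assms by (intro radial_herz_norm_hausdorff) auto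
    have "herz_norm \<alpha> q p2 p1 (hausdorff_op \<Phi> f)
        \<le> ennreal (\<omega> powr (1 / p1)) * (ennreal D * hausdorff_const (real ?n / p2 + \<alpha>) \<Phi> * radial_herz_norm ?n \<alpha> q p2 u)"
      unfolding herz_op using assms
      by (intro mult_left_mono order.trans[OF radial_herz_norm_mono bound] hI) auto
    also have "\<dots> = ennreal C * hausdorff_const (real ?n / p2 + \<alpha>) \<Phi> * herz_norm \<alpha> q p2 p1' f"
    proof -
      have "ennreal (\<omega> powr (1 / p1)) * ennreal D = ennreal C * ennreal (\<omega> powr (1 / p1'))"
        using \<omega>(1) by (simp add: C_def flip: ennreal_mult' ennreal_mult'')
      then show ?thesis
        by (simp add: herz_f mult.assoc[symmetric]) (simp add: ac_simps)
    qed
    finally have main: "herz_norm \<alpha> q p2 p1 (hausdorff_op \<Phi> f)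
      \<le> ennreal C * hausdorff_const (real ?n / p2 + \<alpha>) \<Phi> * herz_norm \<alpha> q p2 p1' f" .
    \<comment> \<open>Finiteness of the constant and of the norm of \<open>f\<close> bounds the norm
      of the majorant \<open>I\<close>, so \<open>I (norm x)\<close> is finite almost everywhere,
      which is absolute integrability.\<close>
    have "AE x in lebesgue. integrable lebesgue (hausdorff_integrand \<Phi> f x)"
      if fin: "hausdorff_const (real ?n / p2 + \<alpha>) \<Phi> < \<infinity>"
    proof -
      have "herz_norm \<alpha> q p2 p1' f < \<infinity>"
        using f by (simp add: herz_space_def)
      then have "radial_herz_norm ?n \<alpha> q p2 u < \<infinity>"
        using \<omega>(1) by (auto simp: herz_f ennreal_mult_less_top)
      then have "radial_herz_norm ?n \<alpha> q p2 I < \<infinity>"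
        using fin by (intro le_less_trans[OF bound]) (simp add: ennreal_mult_less_top)
      then have "AE r in lborel. 0 < r \<longrightarrow> I r < \<infinity>"
        by (intro radial_herz_norm_finite_AE I)
      then have "AE x::real ^ 'n in lborel. 0 < norm x \<longrightarrow> I (norm x) < \<infinity>"
        by (rule AE_lborel_norm)
      then have "AE x in lborel. integrable lebesgue (hausdorff_integrand \<Phi> f x)"
        using AE_lborel_singleton[of 0]
      proof eventually_elim
        case (elim x)
        then have "I (norm x) < \<infinity>" by simp
        then have "integrable lborel (J (norm x))"
          by (simp add: integrable_iff_bounded normJ I_def)
        then have "integrable lebesgue (J (norm x))"
          by (simp add: integrable_completion)
        then show ?case
          by (subst integrable_cong_AE[OF integrand_measurable[OF elim(2)] measurable_completion[OF Jr]
                AE_completion[OF integrand[OF elim(2)]]])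
      qed
      then show ?thesis by (rule AE_completion)
    qed
    moreover have "hausdorff_op \<Phi> f \<in> borel_measurable lebesgue"
    proof (rule AE_imp_measurable_completion)
      show "AE x in lborel. hausdorff_op \<Phi> f x = h (norm x)"
        using AE_lborel_singleton[of 0] by eventually_elim (rule op)
    qed auto
    ultimately show ?thesis using main by blast
  qed
  ultimately show ?thesis by blast
qed

end
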